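(* Let $A,B_1,B_2$ be bounded selfadjoint operators on a complex Hilbert space $\mathcal{H}$, and assume that $\{B_1,B_2\}$ is weakly indefinite. Then $$\langle Ax,x\rangle\ge0\ \text{ for every } x\in Q_1\cap Q_2$$ if and only if the set $$\Omega=\{(\lambda_1,\lambda_2)\in\mathbb{R}^2: A+\lambda_1B_1+\lambda_2B_2\ge 0\}$$ is nonempty.
   Context: $(\mathcal{H},\langle\cdot,\cdot\rangle)$ is a complex Hilbert space. For a bounded selfadjoint operator $T$, $T\ge0$ means $\langle Tx,x\rangle\ge0$ for all $x\in\mathcal{H}$; $T$ is indefinite if there exist $x_+,x_-\in\mathcal{H}$ with $\langle Tx_+,x_+\rangle>0$ and $\langle Tx_-,x_-\rangle<0$. $Q_i=\{x\in\mathcal{H}:\langle B_ix,x\rangle=0\}$. $\{B_1,B_2\}$ is weakly indefinite if $\mu_1B_1+\mu_2B_2$ is indefinite for every $(\mu_1,\mu_2)\in\mathbb{R}^2\setminus\{0\}$. *)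

theory Defs
  imports "HOL-Analysis.Analysis" "HOL-Library.Complex_Order"
begin

text \<open>
  Complex Hilbert spaces, as Banach spaces (complete real normed spaces) that carry in addition a
  complex scalar multiplication extending the real one, and an inner product inducing the norm.
  The inner product is linear in its first argument and conjugate linear in its second.
  It takes values in the complex numbers, where \<open>0 \<le> z\<close> (with the order of \<open>Complex_Order\<close>)
  means that \<open>z\<close> is real and nonnegative.
\<close>

class complex_hilbert_space = banach +
  fixes scaleC :: "complex \<Rightarrow> 'a \<Rightarrow> 'a"  (infixr "*\<^sub>C" 75)
    and cinner :: "'a \<Rightarrow> 'a \<Rightarrow> complex"
  assumes scaleR_scaleC: "r *\<^sub>R x = complex_of_real r *\<^sub>C x"
    and scaleC_add_right: "c *\<^sub>C (x + y) = c *\<^sub>C x + c *\<^sub>C y"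
    and scaleC_add_left: "(c + d) *\<^sub>C x = c *\<^sub>C x + d *\<^sub>C x"
    and scaleC_scaleC: "c *\<^sub>C d *\<^sub>C x = (c * d) *\<^sub>C x"
    and scaleC_one: "1 *\<^sub>C x = x"
    and cinner_commute: "cinner x y = cnj (cinner y x)"
    and cinner_add_left: "cinner (x + y) z = cinner x z + cinner y z"
    and cinner_scaleC_left: "cinner (c *\<^sub>C x) y = c * cinner x y"
    and cinner_ge_zero: "0 \<le> cinner x x"
    and cinner_eq_zero_iff: "cinner x x = 0 \<longleftrightarrow> x = 0"
    and norm_eq_sqrt_cinner: "norm x = sqrt (Re (cinner x x))"

definition bounded_clinear :: "('a \<Rightarrow> 'a::complex_hilbert_space) \<Rightarrow> bool" where
  "bounded_clinear T \<longleftrightarrow> bounded_linear T \<and> (\<forall>c x. T (c *\<^sub>C x) = c *\<^sub>C T x)"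

definition bounded_selfadjoint :: "('a \<Rightarrow> 'a::complex_hilbert_space) \<Rightarrow> bool" where
  "bounded_selfadjoint T \<longleftrightarrow> bounded_clinear T \<and> (\<forall>x y. cinner (T x) y = cinner x (T y))"

definition nonneg_op :: "('a \<Rightarrow> 'a::complex_hilbert_space) \<Rightarrow> bool" where
  "nonneg_op T \<longleftrightarrow> (\<forall>x. 0 \<le> cinner (T x) x)"

definition indefinite :: "('a \<Rightarrow> 'a::complex_hilbert_space) \<Rightarrow> bool" where
  "indefinite T \<longleftrightarrow> (\<exists>x. 0 < cinner (T x) x) \<and> (\<exists>x. cinner (T x) x < 0)"

definition neutral_set :: "('a \<Rightarrow> 'a::complex_hilbert_space) \<Rightarrow> 'a set" where
  "neutral_set B = {x. cinner (B x) x = 0}"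

definition weakly_indefinite ::
    "('a \<Rightarrow> 'a) \<Rightarrow> ('a \<Rightarrow> 'a::complex_hilbert_space) \<Rightarrow> bool" where
  "weakly_indefinite B\<^sub>1 B\<^sub>2 \<longleftrightarrow>
     (\<forall>\<mu>\<^sub>1 \<mu>\<^sub>2 :: real. (\<mu>\<^sub>1, \<mu>\<^sub>2) \<noteq> (0, 0) \<longrightarrow> indefinite (\<lambda>x. \<mu>\<^sub>1 *\<^sub>R B\<^sub>1 x + \<mu>\<^sub>2 *\<^sub>R B\<^sub>2 x))"

end

theory Submission
  imports Defs
begin

text \<open>
  As \<open>x\<close> ranges over the space, the points \<open>(\<langle>Ax,x\<rangle>, \<langle>B\<^sub>1x,x\<rangle>, \<langle>B\<^sub>2x,x\<rangle>)\<close> form a convex cone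
  \<open>W\<close> in three-dimensional real space: on the span of two vectors the three forms are linear
  functionals on the four-dimensional real space of hermitian \<open>2 \<times> 2\<close> matrices, so they vanish
  at some hermitian \<open>K \<noteq> 0\<close>, and the line through the identity in direction \<open>K\<close> meets the
  positive semidefinite matrices of rank at most one. If \<open>A\<close> is nonnegative on the common
  neutral set, \<open>W\<close> misses the ray \<open>{(s, 0, 0). s < 0}\<close>. A hyperplane separating the two has
  nonzero first coefficient by weak indefiniteness, and the multipliers can be read off from it.
\<close>

definition qform :: "('a \<Rightarrow> 'a::complex_hilbert_space) \<Rightarrow> 'a \<Rightarrow> real" where
  "qform T x = Re (cinner (T x) x)"

lemma cinner_add_right: "cinner x (y + z) = cinner x y + cinner x z"
  for x :: "'a::complex_hilbert_space"
  by (metis cinner_add_left cinner_commute complex_cnj_add)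

lemma cinner_scaleC_right: "cinner x (c *\<^sub>C y) = cnj c * cinner x y"
  for x :: "'a::complex_hilbert_space"
  by (metis cinner_commute cinner_scaleC_left complex_cnj_mult)

lemma cinner_scaleR_left: "cinner (r *\<^sub>R x) y = complex_of_real r * cinner x y"
  for x :: "'a::complex_hilbert_space"
  by (simp add: scaleR_scaleC cinner_scaleC_left)

text \<open>The value equals its own conjugate, hence is real. This carries statements in the
  complex order over to the real-valued \<open>qform\<close>.\<close>

lemma cinner_selfadjoint_eq_qform:
  assumes "bounded_selfadjoint T"
  shows "cinner (T x) x = complex_of_real (qform T x)"
proof -
  have "cinner (T x) x = cnj (cinner (T x) x)"
    using assms by (metis bounded_selfadjoint_def cinner_commute)
  then have "Im (cinner (T x) x) = 0"
    by (simp add: complex_eq_iff)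
  then show ?thesis
    by (simp add: qform_def complex_eq_iff)
qed

text \<open>The vector \<open>(a, b)\<close> enters only through the entries of its rank-one
  hermitian matrix, and these enter real-linearly.\<close>

lemma qform_combination:
  assumes "bounded_selfadjoint T"
  shows "qform T (a *\<^sub>C x + b *\<^sub>C y) =
    (cmod a)\<^sup>2 * qform T x + (cmod b)\<^sup>2 * qform T y + 2 * Re (a * cnj b * cinner (T x) y)"
proof -
  have T: "T (u + v) = T u + T v" "T (c *\<^sub>C u) = c *\<^sub>C T u" for u v c
    using assms linear_add
    by (auto simp: bounded_selfadjoint_def bounded_clinear_def dest: bounded_linear.linear)
  have sym: "cinner (T y) x = cnj (cinner (T x) y)"
    using assms by (metis bounded_selfadjoint_def cinner_commute)
  have "cinner (T (a *\<^sub>C x + b *\<^sub>C y)) (a *\<^sub>C x + b *\<^sub>C y) =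
      (a * cnj a) * cinner (T x) x + (b * cnj b) * cinner (T y) y +
      (a * cnj b * cinner (T x) y + cnj (a * cnj b * cinner (T x) y))"
    by (simp add: T sym cinner_add_left cinner_add_right cinner_scaleC_left cinner_scaleC_right
        algebra_simps)
  also have "Re \<dots> =
      (cmod a)\<^sup>2 * qform T x + (cmod b)\<^sup>2 * qform T y + 2 * Re (a * cnj b * cinner (T x) y)"
    unfolding complex_norm_square[symmetric] complex_add_cnj by (simp add: qform_def)
  finally show ?thesis
    by (simp add: qform_def)
qed

lemma qform_scaleR:
  assumes "bounded_selfadjoint T"
  shows "qform T (r *\<^sub>R x) = r\<^sup>2 * qform T x"
  using assms
  by (simp add: bounded_selfadjoint_def bounded_clinear_def qform_def scaleR_scaleC
      cinner_scaleC_left cinner_scaleC_right power2_eq_square)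

lemma qform_zero: "bounded_selfadjoint T \<Longrightarrow> qform T 0 = 0"
  using qform_scaleR[of T 0 0] by simp

text \<open>A positive semidefinite 2 by 2 matrix of determinant zero is a column times its adjoint.
  Choosing \<open>a\<close> real forces \<open>b\<close>, unless \<open>P\<close> is zero, and then
  \<open>w\<close> vanishes as well.\<close>

lemma psd_rank_one_decomposition:
  fixes P R :: real and w :: complex
  assumes "0 \<le> P" "0 \<le> R" "P * R = (cmod w)\<^sup>2"
  obtains a b where "(cmod a)\<^sup>2 = P" "(cmod b)\<^sup>2 = R" "a * cnj b = w"
proof (cases "P = 0")
  case True
  then show ?thesis
    using assms that[of 0 "complex_of_real (sqrt R)"] by auto
next
  case False
  have "(cmod (cnj w / complex_of_real (sqrt P)))\<^sup>2 = R"
    using assms False by (simp add: norm_divide power_divide flip: assms(3))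
  then show ?thesis
    using assms False
      that[of "complex_of_real (sqrt P)" "cnj w / complex_of_real (sqrt P)"] by simp
qed

text \<open>
  Here \<open>P\<close>, \<open>R\<close>, \<open>t * w\<close> are the entries of the identity plus \<open>t\<close> times the matrix with
  diagonal \<open>p\<close>, \<open>r\<close> and off-diagonal entry \<open>w\<close>; the scalar \<open>- 1 / t\<close> is the eigenvalue
  of largest modulus.
\<close>

lemma line_meets_psd_boundary:
  fixes p r :: real and w :: complex
  assumes "(p, r, w) \<noteq> 0"
  obtains t where "0 \<le> 1 + t * p" "0 \<le> 1 + t * r"
    "(1 + t * p) * (1 + t * r) = t\<^sup>2 * (cmod w)\<^sup>2"
proof -
  have nonneg_trace: "\<exists>t. 0 \<le> 1 + t * p \<and> 0 \<le> 1 + t * r \<and>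
      (1 + t * p) * (1 + t * r) = t\<^sup>2 * (cmod w)\<^sup>2"
    if "(p, r, w) \<noteq> 0" "0 \<le> p + r" for p r w
  proof -
    \<comment> \<open>\<open>l\<close> is the larger root of the characteristic polynomial and
      \<open>d\<close> half the gap between the roots.\<close>
    define d where "d = sqrt (((p - r) / 2)\<^sup>2 + (cmod w)\<^sup>2)"
    define l where "l = (p + r) / 2 + d"
    have d2: "d\<^sup>2 = ((p - r) / 2)\<^sup>2 + (cmod w)\<^sup>2"
      by (simp add: d_def)
    have d_ge: "\<bar>(p - r) / 2\<bar> \<le> d"
      unfolding d_def by (rule real_le_rsqrt) (simp add: power_divide)
    have "0 \<le> d" using d_ge by linarith
    have "l \<noteq> 0"
    proof
      assume "l = 0"
      with \<open>0 \<le> d\<close> that(2) have "d = 0" "p + r = 0" by (simp_all add: l_def add_nonneg_eq_0_iff)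
      with d2 d_ge that(1) show False by (auto simp: zero_prod_def)
    qed
    with \<open>0 \<le> d\<close> that(2) have l: "0 < l" by (simp add: l_def less_le)
    have "(l - p) * (l - r) = (cmod w)\<^sup>2"
      using d2 by (simp add: l_def power2_eq_square field_simps)
    moreover have "p \<le> l" "r \<le> l"
      using d_ge by (auto simp: l_def field_simps)
    ultimately show ?thesis
      using l by (intro exI[of _ "- 1 / l"]) (simp add: field_simps power2_eq_square)
  qed
  show ?thesis
  proof (cases "0 \<le> p + r")
    case True
    with nonneg_trace[OF assms] that show ?thesis by blast
  next
    case False
    have "(- p, - r, - w) \<noteq> 0"
      using assms by (simp add: zero_prod_def)
    with False nonneg_trace[of "- p" "- r" "- w"] obtain t where
      "0 \<le> 1 + t * - p" "0 \<le> 1 + t * - r"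
      "(1 + t * - p) * (1 + t * - r) = t\<^sup>2 * (cmod (- w))\<^sup>2"
      by auto
    then show ?thesis
      using that[of "- t"] by simp
  qed
qed

lemma three_qforms_sum_attained:
  assumes "bounded_selfadjoint S" "bounded_selfadjoint T" "bounded_selfadjoint U"
  obtains z where "qform S z = qform S x + qform S y" "qform T z = qform T x + qform T y"
    "qform U z = qform U x + qform U y"
proof -
  define g where
    \<comment> \<open>\<open>k\<close> lists the diagonal and the off-diagonal entry of a hermitian
      matrix. At the identity, \<open>g V\<close> is \<open>qform V x + qform V y\<close>.\<close>
    "g V k = fst k * qform V x + fst (snd k) * qform V y + 2 * Re (snd (snd k) * cinner (V x) y)"
    for V and k :: "real \<times> real \<times> complex"
  define f where "f k = (g S k, g T k, g U k)" for k
  have lin: "linear f"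
    by (rule linearI) (simp_all add: f_def g_def algebra_simps)
  have "\<not> inj f"
  \<comment> \<open>The real dimension is 4 in the domain and 3 in the codomain.\<close>
  proof
    assume "inj f"
    then have "dim (range f) = dim (UNIV :: (real \<times> real \<times> complex) set)"
      using lin by (intro dim_image_eq) (auto intro: inj_on_subset)
    then show False
      using dim_subset_UNIV[of "range f"] by simp
  qed
  then obtain k where "k \<noteq> 0" "f k = 0"
    using lin by (auto simp: linear_injective_0)
  obtain p r w where k: "k = (p, r, w)"
    by (metis prod.exhaust)
  obtain t where t: "0 \<le> 1 + t * p" "0 \<le> 1 + t * r"
    "(1 + t * p) * (1 + t * r) = t\<^sup>2 * (cmod w)\<^sup>2"
    using line_meets_psd_boundary \<open>k \<noteq> 0\<close> unfolding k by blast
  obtain a b where ab: "(cmod a)\<^sup>2 = 1 + t * p" "(cmod b)\<^sup>2 = 1 + t * r" "a * cnj b = t * w"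
    using psd_rank_one_decomposition[OF t(1,2), of "t * w"] t(3)
    by (auto simp: norm_mult power_mult_distrib)
  have "qform V (a *\<^sub>C x + b *\<^sub>C y) = qform V x + qform V y"
    if "bounded_selfadjoint V" "g V k = 0" for V
  proof -
    \<comment> \<open>By \<open>ab\<close>, the matrix of \<open>(a, b)\<close> is the identity plus
      \<open>t\<close> times \<open>k\<close>.\<close>
    have "qform V (a *\<^sub>C x + b *\<^sub>C y) = qform V x + qform V y + t * g V k"
      unfolding qform_combination[OF that(1)] ab
      by (simp add: g_def k algebra_simps)
    with that(2) show ?thesis by simp
  qed
  moreover have "g S k = 0" "g T k = 0" "g U k = 0"
    using \<open>f k = 0\<close> by (simp_all add: f_def zero_prod_def)
  ultimately show ?thesis
    using assms that by blast
qed

lemma convex_range_three_qforms: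
  assumes "bounded_selfadjoint S" "bounded_selfadjoint T" "bounded_selfadjoint U"
  shows "convex (range (\<lambda>x. (qform S x, qform T x, qform U x)))"
proof (rule convexI)
  fix v v' u u'
  assume v: "v \<in> range (\<lambda>x. (qform S x, qform T x, qform U x))"
    and v': "v' \<in> range (\<lambda>x. (qform S x, qform T x, qform U x))"
    and u: "0 \<le> u" "0 \<le> u'" "u + u' = (1::real)"
  obtain x y where xy: "v = (qform S x, qform T x, qform U x)" "v' = (qform S y, qform T y, qform U y)"
    using v v' by blast
  \<comment> \<open>Forms scale quadratically, so square roots absorb the weights.\<close>
  obtain z where "qform S z = qform S (sqrt u *\<^sub>R x) + qform S (sqrt u' *\<^sub>R y)"
    "qform T z = qform T (sqrt u *\<^sub>R x) + qform T (sqrt u' *\<^sub>R y)"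
    "qform U z = qform U (sqrt u *\<^sub>R x) + qform U (sqrt u' *\<^sub>R y)"
    using three_qforms_sum_attained[OF assms] by blast
  then have "u *\<^sub>R v + u' *\<^sub>R v' = (qform S z, qform T z, qform U z)"
    using u by (simp add: xy qform_scaleR assms)
  then show "u *\<^sub>R v + u' *\<^sub>R v' \<in> range (\<lambda>x. (qform S x, qform T x, qform U x))"
    by blast
qed

lemma exists_nonneg_combination:
  assumes sa: "bounded_selfadjoint A" "bounded_selfadjoint B\<^sub>1" "bounded_selfadjoint B\<^sub>2"
    and nonneg: "\<And>x. qform B\<^sub>1 x = 0 \<Longrightarrow> qform B\<^sub>2 x = 0 \<Longrightarrow> 0 \<le> qform A x"
  obtains \<alpha> \<beta>\<^sub>1 \<beta>\<^sub>2 where "(\<alpha>, \<beta>\<^sub>1, \<beta>\<^sub>2) \<noteq> (0, 0, 0)" "0 \<le> \<alpha>"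
    "\<And>x. 0 \<le> \<alpha> * qform A x + \<beta>\<^sub>1 * qform B\<^sub>1 x + \<beta>\<^sub>2 * qform B\<^sub>2 x"
proof -
  let ?W = "range (\<lambda>x. (qform A x, qform B\<^sub>1 x, qform B\<^sub>2 x))"
  \<comment> \<open>The ray must omit the origin, which lies in \<open>?W\<close>.\<close>
  let ?N = "{..<0::real} \<times> {0::real} \<times> {0::real}"
  have "?N \<inter> ?W = {}"
    using nonneg by force
  moreover have "convex ?N"
    by (intro convex_Times) auto
  moreover have "?N \<noteq> {}"
    by (auto simp: lessThan_empty_iff)
  ultimately obtain h c where h: "h \<noteq> 0" "\<forall>v\<in>?N. inner h v \<le> c" "\<forall>v\<in>?W. c \<le> inner h v"
    using separating_hyperplane_sets[of ?N ?W] convex_range_three_qforms[OF sa] by blast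
  obtain \<alpha> \<beta>\<^sub>1 \<beta>\<^sub>2 where hs: "h = (\<alpha>, \<beta>\<^sub>1, \<beta>\<^sub>2)"
    by (metis prod.exhaust)
  let ?q = "\<lambda>x. \<alpha> * qform A x + \<beta>\<^sub>1 * qform B\<^sub>1 x + \<beta>\<^sub>2 * qform B\<^sub>2 x"
  have W: "c \<le> ?q x" for x
    using h(3) by (auto simp: hs inner_prod_def add.assoc)
  have "c \<le> 0"
    using W[of 0] by (simp add: qform_zero sa)
  have "\<alpha> * (-1) \<le> c"
    using bspec[OF h(2), of "(-1, 0, 0)"] by (simp add: hs inner_prod_def)
  with \<open>c \<le> 0\<close> have "0 \<le> \<alpha>"
    by simp
  have "0 \<le> ?q x" for x
  proof (rule ccontr)
    assume neg: "\<not> 0 \<le> ?q x"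
    \<comment> \<open>Since \<open>?W\<close> is a cone, a negative value of \<open>?q\<close> could
      be rescaled to \<open>c - 1\<close>, below the bound \<open>c\<close>.\<close>
    define s where "s = (c - 1) / ?q x"
    have "0 \<le> s"
      using neg \<open>c \<le> 0\<close> by (simp add: s_def divide_nonpos_nonpos)
    then have "?q (sqrt s *\<^sub>R x) = s * ?q x"
      by (simp add: qform_scaleR sa algebra_simps)
    also have "\<dots> = c - 1"
      using neg by (simp add: s_def)
    finally show False
      using W[of "sqrt s *\<^sub>R x"] by simp
  qed
  with that h(1) \<open>0 \<le> \<alpha>\<close> show ?thesis
    by (auto simp: hs zero_prod_def)
qed

lemma cinner_combination:
  assumes "bounded_selfadjoint A" "bounded_selfadjoint B\<^sub>1" "bounded_selfadjoint B\<^sub>2"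
  shows "cinner (A x + l\<^sub>1 *\<^sub>R B\<^sub>1 x + l\<^sub>2 *\<^sub>R B\<^sub>2 x) x =
    complex_of_real (qform A x + l\<^sub>1 * qform B\<^sub>1 x + l\<^sub>2 * qform B\<^sub>2 x)"
  by (simp add: cinner_add_left cinner_scaleR_left cinner_selfadjoint_eq_qform assms)

theorem theorem2p4:
  fixes A B\<^sub>1 B\<^sub>2 :: "'a::complex_hilbert_space \<Rightarrow> 'a"
  assumes "bounded_selfadjoint A" and "bounded_selfadjoint B\<^sub>1" and "bounded_selfadjoint B\<^sub>2"
    and "weakly_indefinite B\<^sub>1 B\<^sub>2"
  shows "(\<forall>x \<in> neutral_set B\<^sub>1 \<inter> neutral_set B\<^sub>2. 0 \<le> cinner (A x) x) \<longleftrightarrow>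
    {(l\<^sub>1 :: real, l\<^sub>2 :: real). nonneg_op (\<lambda>x. A x + l\<^sub>1 *\<^sub>R B\<^sub>1 x + l\<^sub>2 *\<^sub>R B\<^sub>2 x)} \<noteq> {}"
    (is "?L \<longleftrightarrow> ?R")
proof
  assume ?L
  then have "0 \<le> qform A x" if "qform B\<^sub>1 x = 0" "qform B\<^sub>2 x = 0" for x
    using that by (auto simp: neutral_set_def cinner_selfadjoint_eq_qform assms(1-3) less_eq_complex_def)
  then obtain \<alpha> \<beta>\<^sub>1 \<beta>\<^sub>2 where nz: "(\<alpha>, \<beta>\<^sub>1, \<beta>\<^sub>2) \<noteq> (0, 0, 0)" and "0 \<le> \<alpha>"
    and comb: "\<And>x. 0 \<le> \<alpha> * qform A x + \<beta>\<^sub>1 * qform B\<^sub>1 x + \<beta>\<^sub>2 * qform B\<^sub>2 x"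
    using exists_nonneg_combination[OF assms(1-3)] by metis
  have "\<alpha> \<noteq> 0"
  proof
    \<comment> \<open>Otherwise a nontrivial combination of \<open>B\<^sub>1\<close> and
      \<open>B\<^sub>2\<close> would be nonnegative, against weak indefiniteness.\<close>
    assume "\<alpha> = 0"
    with nz assms(4) obtain x where "cinner (\<beta>\<^sub>1 *\<^sub>R B\<^sub>1 x + \<beta>\<^sub>2 *\<^sub>R B\<^sub>2 x) x < 0"
      by (auto simp: weakly_indefinite_def indefinite_def)
    then have "\<beta>\<^sub>1 * qform B\<^sub>1 x + \<beta>\<^sub>2 * qform B\<^sub>2 x < 0"
      by (simp add: cinner_add_left cinner_scaleR_left qform_def less_complex_def)
    with comb[of x] \<open>\<alpha> = 0\<close> show False
      by simp
  qed
  with \<open>0 \<le> \<alpha>\<close> have "0 \<le> qform A x + \<beta>\<^sub>1 / \<alpha> * qform B\<^sub>1 x + \<beta>\<^sub>2 / \<alpha> * qform B\<^sub>2 x" for x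
    using divide_nonneg_nonneg[OF comb[of x], of \<alpha>] by (simp add: add_divide_distrib)
  then have "nonneg_op (\<lambda>x. A x + (\<beta>\<^sub>1 / \<alpha>) *\<^sub>R B\<^sub>1 x + (\<beta>\<^sub>2 / \<alpha>) *\<^sub>R B\<^sub>2 x)"
    unfolding nonneg_op_def cinner_combination[OF assms(1-3)]
    by (simp add: less_eq_complex_def)
  then show ?R
    by blast
next
  assume ?R
  then obtain l\<^sub>1 l\<^sub>2 where
    comb: "0 \<le> cinner (A x + l\<^sub>1 *\<^sub>R B\<^sub>1 x + l\<^sub>2 *\<^sub>R B\<^sub>2 x) x" for x
    by (auto simp: nonneg_op_def)
  show ?L
  proof
    fix x
    assume "x \<in> neutral_set B\<^sub>1 \<inter> neutral_set B\<^sub>2"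
    \<comment> \<open>Both multiplier terms vanish at a common neutral vector.\<close>
    with comb[of x] show "0 \<le> cinner (A x) x"
      by (simp add: neutral_set_def cinner_add_left cinner_scaleR_left)
  qed
qed

end
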